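(* Consider the cascade model with $N$ processors, rates $\lambda_1,\dots,\lambda_N>0$ that are pairwise distinct, and $\beta_{j,j+1}>0$ ($j=1,\dots,N-1$), started from a fixed initial state. Let $\ell(m)=\min_{i\le m}\lambda_i$ and let $\{1,\dots,N\}=G_1\cup\dots\cup G_K$ be the partition into groups, where the groups are the maximal sets of consecutive indices on which $\ell$ is constant. If $|G_k|\le 3$ for all $k$, then for every $j$ the limit $v^*_j=\lim_{t\to\infty}x_j(t)/t$ exists in probability and $v^*_j=\ell(j)$.
   Context: Cascade model with parameters $(\lambda_1,\dots,\lambda_N;\beta_{12},\dots,\beta_{N-1,N})$: a continuous-time process $X(t)=(x_1(t),\dots,x_N(t))\in\mathbb Z^N$. Mutually independent Poisson flows: $\Pi^k$ of intensity $\lambda_k$ for each $k$, and $\Pi^{k,k+1}$ of intensity $\beta_{k,k+1}$ for $k=1,\dots,N-1$. At each point of $\Pi^k$, $x_k$ increases by $1$. At each point $\sigma$ of $\Pi^{k,k+1}$, processor $k$ sends processor $k+1$ a message carrying $x_k(\sigma)$, arriving instantly; if $x_{k+1}(\sigma)>x_k(\sigma)$ then $x_{k+1}(\sigma+0)=x_k(\sigma)$ (rollback). Whenever a processor $l$ is rolled back at time $\sigma$ to value $x$, all messages sent by $l$ during $(\theta,\sigma)$, with $\theta=\max\{s\le\sigma:x_l(s)=x,\ x_l(s+0)=x+1\}$, are cancelled; if the recipient $q=l+1$ of a cancelled message sent at time $s'$ has current local time larger than $x_l(s')$, then $x_q$ is rolled back to $x_l(s')$ and its messages are cancelled likewise,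 and so on (cascading rollback). Since $\ell$ is nonincreasing, its level sets are intervals of consecutive indices: there are $1=j_1<j_2<\dots<j_K<j_{K+1}=N+1$ with $G_k=\{j_k,\dots,j_{k+1}-1\}$ and $\ell(j_k)=\dots=\ell(j_{k+1}-1)$, $\ell(j_k-1)>\ell(j_k)$, $\ell(j_{k+1}-1)>\lambda_{j_{k+1}}$. *)

theory Defs
  imports "HOL-Probability.Probability"
begin

text \<open>Event labels: a point of the flow Pi^k is Inc k (processor k increments its local time),
  a point of the flow Pi^{k,k+1} is Msg k (processor k sends a message to processor k+1).
  Processors are indexed 1..N.\<close>
datatype ev = Inc nat | Msg nat

text \<open>State of the system after some events.
  cx: current local times x_l.
  cincs: log of all increments, entries (step, processor, value before the increment);
         these are exactly the times s with x_l(s) = x, x_l(s+0) = x+1.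
  cmsgs: log of sent, not (yet) cancelled messages, entries (step, sender, carried value).
  Steps are the indices of events in the time-ordered event sequence.\<close>
record cstate =
  cx :: "nat \<Rightarrow> int"
  cincs :: "(nat \<times> nat \<times> int) list"
  cmsgs :: "(nat \<times> nat \<times> int) list"

text \<open>theta: last step at which processor l jumped from value v to v+1 (None if there is no
  such step, in which case all messages ever sent by l count as sent after theta).\<close>
definition theta :: "cstate \<Rightarrow> nat \<Rightarrow> int \<Rightarrow> nat option" where
  "theta st l v = (let S = {s. (s, l, v) \<in> set (cincs st)} in
     if S = {} then None else Some (Max S))"

definition after :: "nat option \<Rightarrow> nat \<Rightarrow> bool" where
  "after th s = (case th of None \<Rightarrow> True | Some t \<Rightarrow> t < s)"

text \<open>Cascading rollback: processor l is rolled back to value v (if its current value exceeds v);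
  its messages sent after theta are cancelled; the recipient l+1 is then rolled back to the
  smallest value carried by a cancelled message (if it exceeds it), and so on.
  The first argument is fuel (N suffices, since the cascade moves from l to l+1).\<close>
fun cascade :: "nat \<Rightarrow> nat \<Rightarrow> nat \<Rightarrow> int \<Rightarrow> cstate \<Rightarrow> cstate" where
  "cascade 0 N l v st = st"
| "cascade (Suc f) N l v st =
     (if N < l \<or> cx st l \<le> v then st else
      (let th = theta st l v;
           canc = filter (\<lambda>(s, p, w). p = l \<and> after th s) (cmsgs st);
           st' = st\<lparr> cx := (cx st)(l := v),
                     cmsgs := filter (\<lambda>m. m \<notin> set canc) (cmsgs st) \<rparr>
       in if canc = [] then st'
          else cascade f N (Suc l) (Min (set (map (\<lambda>(s, p, w). w) canc))) st'))"

fun cstep :: "nat \<Rightarrow> nat \<Rightarrow> ev \<Rightarrow> cstate \<Rightarrow> cstate" where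
  "cstep N n (Inc k) st =
     st\<lparr> cx := (cx st)(k := cx st k + 1), cincs := (n, k, cx st k) # cincs st \<rparr>"
| "cstep N n (Msg k) st =
     cascade N N (Suc k) (cx st k) (st\<lparr> cmsgs := (n, k, cx st k) # cmsgs st \<rparr>)"

definition crun :: "nat \<Rightarrow> (nat \<Rightarrow> int) \<Rightarrow> ev list \<Rightarrow> cstate" where
  "crun N x0 es = foldl (\<lambda>st (n, e). cstep N n e st)
      \<lparr> cx = x0, cincs = [], cmsgs = [] \<rparr> (zip [0..<length es] es)"

definition flows :: "nat \<Rightarrow> ev list" where
  "flows N = map Inc [1..<Suc N] @ map Msg [1..<N]"

definition rate :: "(nat \<Rightarrow> real) \<Rightarrow> (nat \<Rightarrow> real) \<Rightarrow> ev \<Rightarrow> real" where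
  "rate lam beta e = (case e of Inc k \<Rightarrow> lam k | Msg k \<Rightarrow> beta k)"

text \<open>Sample space: i.i.d. exponential inter-arrival times, omega (f, i) being the i-th
  inter-arrival time of the flow f (rate lam k for Inc k, beta k for Msg k).
  The flows are thus mutually independent Poisson flows.\<close>
definition cascade_space :: "nat \<Rightarrow> (nat \<Rightarrow> real) \<Rightarrow> (nat \<Rightarrow> real) \<Rightarrow> (ev \<times> nat \<Rightarrow> real) measure" where
  "cascade_space N lam beta =
     PiM (set (flows N) \<times> UNIV) (\<lambda>(f, i). density lborel (exponential_density (rate lam beta f)))"

definition arrival :: "(ev \<times> nat \<Rightarrow> real) \<Rightarrow> ev \<Rightarrow> nat \<Rightarrow> real" where
  "arrival \<omega> f m = (\<Sum>i\<le>m. \<omega> (f, i))"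

definition npoints :: "(ev \<times> nat \<Rightarrow> real) \<Rightarrow> ev \<Rightarrow> real \<Rightarrow> nat" where
  "npoints \<omega> f t = card {m. arrival \<omega> f m \<le> t}"

definition events_upto :: "nat \<Rightarrow> (ev \<times> nat \<Rightarrow> real) \<Rightarrow> real \<Rightarrow> ev list" where
  "events_upto N \<omega> t = map snd (sort_key fst
      (concat (map (\<lambda>f. map (\<lambda>m. (arrival \<omega> f m, f)) [0..<npoints \<omega> f t]) (flows N))))"

definition xproc :: "nat \<Rightarrow> (nat \<Rightarrow> int) \<Rightarrow> (ev \<times> nat \<Rightarrow> real) \<Rightarrow> real \<Rightarrow> nat \<Rightarrow> int" where
  "xproc N x0 \<omega> t j = cx (crun N x0 (events_upto N \<omega> t)) j"

definition ell :: "(nat \<Rightarrow> real) \<Rightarrow> nat \<Rightarrow> real" where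
  "ell lam m = Min (lam ` {1..m})"

end

theory Submission
  imports Defs
begin

text \<open>
  A message that is cancelled when its sender is rolled back to \<open>v\<close> carries a value above \<open>v\<close>: it
  was sent after the last jump of the sender from \<open>v\<close> to \<open>v + 1\<close>. Hence every rollback leaves a
  processor at or above its predecessor, and since its last rollback it has only been incremented;
  this gives \<open>x\<^sub>j(t) \<ge> min (ell (j-1)) (lam j) * t - o(t)\<close> by induction on \<open>j\<close>. Conversely each message leaves
  its recipient at or below the sender, and the time since the last message is negligible, so the
  same expression is an upper bound. Both estimates are pathwise: they only need the counting
  function of each flow to be uniformly close to its mean on \<open>[0, t]\<close>, and this holds with
  probability tending to one by Chebyshev's inequality on a finite grid and monotonicity.
\<close>

section \<open>The message log and the effect of one cascade on the local times\<close>

section \<open>Cascades\<close>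


text \<open>Invariant behind the cascade analysis. A sender that carried \<open>w\<close> at step
  \<open>s\<close> and is now above some \<open>v \<ge> w\<close> must have jumped from
  \<open>v\<close> to \<open>v + 1\<close> after \<open>s\<close>, so \<open>theta\<close> for a
  rollback to \<open>v\<close> lies after \<open>s\<close> and the message survives that
  rollback.\<close>

definition logged :: "nat \<Rightarrow> cstate \<Rightarrow> bool" where
  "logged n st \<longleftrightarrow> (\<forall>s l w. (s, l, w) \<in> set (cmsgs st) \<longrightarrow> s < n \<and>
     (\<forall>v. w \<le> v \<longrightarrow> v < cx st l \<longrightarrow> (\<exists>s'>s. (s', l, v) \<in> set (cincs st))))"

lemma loggedD:
  assumes "logged n st" "(s, l, w) \<in> set (cmsgs st)"
  shows "s < n" and "w \<le> v \<Longrightarrow> v < cx st l \<Longrightarrow> \<exists>s'>s. (s', l, v) \<in> set (cincs st)"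
  using assms unfolding logged_def by blast+

lemma not_after_thetaI:
  assumes "(s', l, v) \<in> set (cincs st)" "s < s'"
  shows "\<not> after (theta st l v) s"
proof -
  have fin: "finite {s. (s, l, v) \<in> set (cincs st)}"
    by (rule finite_subset[of _ "fst ` set (cincs st)"]) (auto intro: rev_image_eqI)
  have "s' \<le> Max {s. (s, l, v) \<in> set (cincs st)}"
    using fin assms(1) by (intro Max_ge) auto
  then show ?thesis
    using assms by (auto simp: after_def theta_def Let_def)
qed

text \<open>A rollback deletes messages and lowers local times while keeping the increment log, so
  it only weakens what the invariant demands.\<close>

lemma logged_mono:
  assumes "logged n st" "set (cmsgs st') \<subseteq> set (cmsgs st)" "cincs st' = cincs st"
    and "\<And>m. cx st' m \<le> cx st m"
  shows "logged n st'"
  unfolding logged_def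
proof (intro allI impI conjI)
  fix s l w assume "(s, l, w) \<in> set (cmsgs st')"
  then have m: "(s, l, w) \<in> set (cmsgs st)" using assms(2) by blast
  then show "s < n" using assms(1) unfolding logged_def by blast
  fix v assume "w \<le> v" "v < cx st' l"
  moreover from this(2) have "v < cx st l" using assms(4)[of l] by linarith
  ultimately show "\<exists>s'>s. (s', l, v) \<in> set (cincs st')"
    using assms(1,3) m unfolding logged_def by simp
qed

lemma cascade_keeps_log:
  "cincs (cascade f N l v st) = cincs st" (is ?A)
  "set (cmsgs (cascade f N l v st)) \<subseteq> set (cmsgs st)" (is ?B)
  "cx (cascade f N l v st) m \<le> cx st m" (is ?C)
  "m < l \<Longrightarrow> cx (cascade f N l v st) m = cx st m"
proof -
  have "?A \<and> ?B \<and> (\<forall>m. cx (cascade f N l v st) m \<le> cx st m) \<and>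
      (\<forall>m<l. cx (cascade f N l v st) m = cx st m)"
  proof (induction f arbitrary: l v st)
    case (Suc f)
    show ?case
    proof (cases "N < l \<or> cx st l \<le> v")
      case False
      define canc where "canc = filter (\<lambda>(s, p, w). p = l \<and> after (theta st l v) s) (cmsgs st)"
      define st' where "st' = st\<lparr> cx := (cx st)(l := v), cmsgs := filter (\<lambda>m. m \<notin> set canc) (cmsgs st) \<rparr>"
      have eq: "cascade (Suc f) N l v st = (if canc = [] then st'
          else cascade f N (Suc l) (Min (set (map (\<lambda>(s, p, w). w) canc))) st')"
        using False by (simp add: Let_def canc_def st'_def)
      have st': "cincs st' = cincs st" "set (cmsgs st') \<subseteq> set (cmsgs st)"
        "\<forall>m. cx st' m \<le> cx st m" "\<forall>m<l. cx st' m = cx st m"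
        using False by (auto simp: st'_def)
      show ?thesis
        unfolding eq using st' Suc[of "Suc l" "Min (set (map (\<lambda>(s, p, w). w) canc))" st']
        by (auto simp: less_Suc_eq intro: order_trans)
    qed auto
  qed simp
  then show ?A ?B ?C "m < l \<Longrightarrow> cx (cascade f N l v st) m = cx st m" by auto
qed

text \<open>Later stages of the cascade touch only processors beyond \<open>l\<close>, so the first
  stage decides the value at \<open>l\<close>.\<close>

lemma cascade_head: "cx (cascade f N l v st) l = (if f = 0 \<or> N < l then cx st l else min (cx st l) v)"
  by (cases f) (auto simp: Let_def cascade_keeps_log)

text \<open>A rollback never pushes a processor below its predecessor. The processor after
  \<open>l\<close> is lowered at most to the smallest cancelled value, which is at least
  \<open>v\<close> by the log invariant; processors further on are covered by induction on the
  fuel.\<close>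

lemma cascade_tail:
  assumes "logged n st" "l \<le> p"
  shows "cx (cascade f N l v st) (Suc p) = cx st (Suc p) \<or>
         cx (cascade f N l v st) p \<le> cx (cascade f N l v st) (Suc p)"
  using assms
proof (induction f arbitrary: l v st)
  case (Suc f)
  show ?case
  proof (cases "N < l \<or> cx st l \<le> v")
    case False
    define canc where "canc = filter (\<lambda>(s, p, w). p = l \<and> after (theta st l v) s) (cmsgs st)"
    define st' where "st' = st\<lparr> cx := (cx st)(l := v), cmsgs := filter (\<lambda>m. m \<notin> set canc) (cmsgs st) \<rparr>"
    define w where "w = Min (set (map (\<lambda>(s, p, w). w) canc))"
    have eq: "cascade (Suc f) N l v st = (if canc = [] then st' else cascade f N (Suc l) w st')"
      using False by (simp add: Let_def canc_def st'_def w_def)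
    have log': "logged n st'"
      by (rule logged_mono[OF Suc.prems(1)]) (use False in \<open>auto simp: st'_def\<close>)
    show ?thesis
    proof (cases "canc = []")
      case True
      then show ?thesis using eq Suc.prems by (simp add: st'_def)
    next
      case ne: False
      \<comment> \<open>A message carrying less than \<open>v\<close> was followed by a jump from
        \<open>v\<close>, because the sender now stands above \<open>v\<close>. It therefore does
        not come after \<open>theta\<close> and cannot be among the cancelled ones.\<close>
      have "v \<le> u" if mem: "(s, q, u) \<in> set canc" for s q u
      proof (rule ccontr)
        assume "\<not> v \<le> u"
        moreover have "(s, l, u) \<in> set (cmsgs st)" "after (theta st l v) s"
          using mem by (auto simp: canc_def)
        moreover obtain s' where "s' > s" "(s', l, v) \<in> set (cincs st)"
          using loggedD(2)[OF Suc.prems(1) calculation(2), of v] False calculation(1) by auto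
        ultimately show False
          using not_after_thetaI by blast
      qed
      then have "v \<le> w"
        unfolding w_def using ne by (subst Min_ge_iff) auto
      moreover have "cx (cascade f N (Suc l) w st') l = v"
        by (simp add: cascade_keeps_log(4) st'_def)
      \<comment> \<open>For \<open>p = l\<close> the recipient either keeps its value or drops to
        \<open>w \<ge> v\<close>; for \<open>p > l\<close> the induction hypothesis applies, since
        \<open>st'\<close> agrees with \<open>st\<close> beyond \<open>l\<close>.\<close>
      ultimately show ?thesis
        using eq ne Suc.IH[OF log', of "Suc l" w] Suc.prems(2)
        by (cases "p = l") (auto simp: cascade_head st'_def min_def)
    qed
  qed auto
qed simp

section \<open>Effect of a single event on a run\<close>

lemma crun_snoc: "crun N x0 (es @ [e]) = cstep N (length es) e (crun N x0 es)"
  by (simp add: crun_def)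

text \<open>The new message carries the current value of its sender, so no \<open>v\<close> lies
  between the two and the condition on it is vacuous.\<close>

lemma logged_add_msg:
  assumes "logged n st"
  shows "logged (Suc n) (st\<lparr> cmsgs := (n, k, cx st k) # cmsgs st \<rparr>)"
  using assms unfolding logged_def by (auto simp: less_Suc_eq)

lemma logged_crun: "logged (length es) (crun N x0 es)"
proof (induction es rule: rev_induct)
  case Nil
  then show ?case by (simp add: crun_def logged_def)
next
  case (snoc e es)
  let ?st = "crun N x0 es" and ?n = "length es"
  show ?case
  proof (cases e)
    case (Inc k)
    show ?thesis
      unfolding logged_def
    proof (intro allI impI conjI)
      fix s l w assume "(s, l, w) \<in> set (cmsgs (crun N x0 (es @ [e])))"
      then have m: "(s, l, w) \<in> set (cmsgs ?st)" by (simp add: crun_snoc Inc)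
      then show "s < length (es @ [e])" using snoc unfolding logged_def by (simp add: less_Suc_eq)
      fix v assume v: "w \<le> v" "v < cx (crun N x0 (es @ [e])) l"
      show "\<exists>s'>s. (s', l, v) \<in> set (cincs (crun N x0 (es @ [e])))"
      proof (cases "v < cx ?st l")
        case True
        with snoc m v(1) obtain s' where "s' > s" "(s', l, v) \<in> set (cincs ?st)"
          unfolding logged_def by blast
        then show ?thesis by (auto simp: crun_snoc Inc)
      next
        \<comment> \<open>The increment brings exactly one new value below the local time, the old
          value of \<open>k\<close>, and its log entry has the current step number, which exceeds
          the step of every logged message.\<close>
        case False
        then have "l = k" "v = cx ?st k" using v(2) by (auto simp: crun_snoc Inc split: if_splits)
        moreover have "s < ?n" using snoc m unfolding logged_def by blast
        ultimately show ?thesis by (auto simp: crun_snoc Inc)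
      qed
    qed
  next
    case (Msg k)
    let ?st' = "?st\<lparr> cmsgs := (?n, k, cx ?st k) # cmsgs ?st \<rparr>"
    have "logged (Suc ?n) (cascade N N (Suc k) (cx ?st k) ?st')"
      using logged_mono[OF logged_add_msg[OF snoc] cascade_keeps_log(2) cascade_keeps_log(1)
          cascade_keeps_log(3)] .
    then show ?thesis
      by (simp add: crun_snoc Msg)
  qed
qed

lemma crun_Inc: "cx (crun N x0 (es @ [Inc k])) j = cx (crun N x0 es) j + (if j = k then 1 else 0)"
  by (simp add: crun_snoc)

lemma crun_Msg_le: "cx (crun N x0 (es @ [Msg k])) j \<le> cx (crun N x0 es) j"
  by (simp add: crun_snoc) (rule order_trans[OF cascade_keeps_log(3)], simp)

lemma crun_Msg_first: "1 \<le> k \<Longrightarrow> cx (crun N x0 (es @ [Msg k])) 1 = cx (crun N x0 es) 1"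
  by (simp add: crun_snoc cascade_keeps_log(4))

lemma crun_Msg_recipient: "k < N \<Longrightarrow>
   cx (crun N x0 (es @ [Msg k])) (Suc k) \<le> cx (crun N x0 (es @ [Msg k])) k"
  by (simp add: crun_snoc cascade_head cascade_keeps_log(4))

text \<open>Processors up to the sender are untouched, the direct recipient falls at most to the
  sender's value, and the rest of the cascade obeys \<open>cascade_tail\<close>.\<close>

lemma crun_Msg_rollback:
  "cx (crun N x0 (es @ [Msg k])) (Suc p) = cx (crun N x0 es) (Suc p) \<or>
   cx (crun N x0 (es @ [Msg k])) p \<le> cx (crun N x0 (es @ [Msg k])) (Suc p)"
proof -
  let ?st = "crun N x0 es\<lparr> cmsgs := (length es, k, cx (crun N x0 es) k) # cmsgs (crun N x0 es) \<rparr>"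
  consider "p < k" | "p = k" | "Suc k \<le> p" by linarith
  then show ?thesis
  proof cases
    case 3
    show ?thesis
      using cascade_tail[OF logged_add_msg[OF logged_crun] 3]
      by (simp add: crun_snoc)
  qed (auto simp: crun_snoc cascade_head cascade_keeps_log(4) min_def)
qed

section \<open>Deterministic linear bounds along an event list\<close>

section \<open>Pathwise bounds\<close>


lemma ell_Suc: "1 \<le> j \<Longrightarrow> ell lam (Suc j) = min (ell lam j) (lam (Suc j))"
  by (simp add: ell_def atLeastAtMostSuc_conv min.commute)

lemma ell_1: "ell lam (Suc 0) = lam (Suc 0)"
  by (simp add: ell_def)

lemma ell_pos: "1 \<le> j \<Longrightarrow> \<forall>k\<in>{1..j}. lam k > 0 \<Longrightarrow> ell lam j > 0"
  by (simp add: ell_def)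

lemma in_flows_iff: "e \<in> set (flows N) \<longleftrightarrow>
    (\<exists>k. 1 \<le> k \<and> k \<le> N \<and> e = Inc k) \<or> (\<exists>k. 1 \<le> k \<and> k < N \<and> e = Msg k)"
  by (auto simp: flows_def image_iff)

text \<open>Processor 1 receives no messages, so it is never rolled back; this starts both
  inductions over the processors.\<close>

lemma crun_first:
  assumes "set es \<subseteq> set (flows N)"
  shows "cx (crun N x0 es) 1 = x0 1 + int (count_list es (Inc 1))"
  using assms
proof (induction es rule: rev_induct)
  case Nil
  then show ?case by (simp add: crun_def)
next
  case (snoc e es)
  then show ?case
    by (cases e) (auto simp: in_flows_iff crun_Inc crun_Msg_first[unfolded One_nat_def])
qed

lemma crun_append_le:
  "cx (crun N x0 (es @ fs)) j \<le> cx (crun N x0 es) j + int (count_list fs (Inc j))"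
proof (induction fs rule: rev_induct)
  case (snoc e fs)
  show ?case
  proof (cases e)
    case (Inc k)
    then show ?thesis using snoc by (auto simp: crun_Inc simp flip: append_assoc)
  next
    case (Msg k)
    then show ?thesis
      using snoc crun_Msg_le[of N x0 "es @ fs" k j] by simp
  qed
qed simp

text \<open>Splits the run just after the last message from \<open>j\<close>, when the recipient is
  at or below the sender. The prefix is empty if there was no such message.\<close>

lemma crun_last_message:
  assumes "j < N"
  shows "\<exists>ps fs. es = ps @ fs \<and> count_list fs (Msg j) = 0 \<and>
      (ps = [] \<or> cx (crun N x0 ps) (Suc j) \<le> cx (crun N x0 ps) j)"
proof (induction es rule: rev_induct)
  case (snoc e es)
  show ?case
  proof (cases "e = Msg j")
    case True
    then show ?thesis
      using crun_Msg_recipient[OF assms, of x0 es]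
      by (intro exI[of _ "es @ [e]"] exI[of _ "[]"]) simp
  next
    case False
    from snoc obtain ps fs where "es = ps @ fs" "count_list fs (Msg j) = 0"
      "ps = [] \<or> cx (crun N x0 ps) (Suc j) \<le> cx (crun N x0 ps) j" by blast
    then show ?thesis
      using False by (intro exI[of _ ps] exI[of _ "fs @ [e]"]) auto
  qed
qed simp

text \<open>Counterpart for the lower bound: after the split point processor \<open>j + 1\<close>
  moves by its own increments only, and at the split point it is at or above \<open>j\<close>. An
  empty prefix stands for the initial state.\<close>

lemma crun_last_rollback:
  "\<exists>ps fs. es = ps @ fs \<and>
      cx (crun N x0 es) (Suc j) = cx (crun N x0 ps) (Suc j) + int (count_list fs (Inc (Suc j))) \<and>
      (ps = [] \<or> cx (crun N x0 ps) j \<le> cx (crun N x0 ps) (Suc j))"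
proof (induction es rule: rev_induct)
  case (snoc e es)
  then obtain ps fs where IH: "es = ps @ fs"
      "cx (crun N x0 es) (Suc j) = cx (crun N x0 ps) (Suc j) + int (count_list fs (Inc (Suc j)))"
      "ps = [] \<or> cx (crun N x0 ps) j \<le> cx (crun N x0 ps) (Suc j)" by blast
  show ?case
  proof (cases e)
    case (Inc k)
    then show ?thesis
      using IH by (intro exI[of _ ps] exI[of _ "fs @ [e]"]) (auto simp: crun_Inc simp flip: append_assoc)
  next
    case (Msg k)
    from crun_Msg_rollback[of N x0 es k j] show ?thesis
    proof
      assume "cx (crun N x0 (es @ [Msg k])) (Suc j) = cx (crun N x0 es) (Suc j)"
      then show ?thesis
        using IH Msg by (intro exI[of _ ps] exI[of _ "fs @ [e]"]) auto
    next
      \<comment> \<open>The ordering holds right after this event, so the split point moves to the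
        end of the list.\<close>
      assume "cx (crun N x0 (es @ [Msg k])) j \<le> cx (crun N x0 (es @ [Msg k])) (Suc j)"
      then show ?thesis
        using Msg by (intro exI[of _ "es @ [e]"] exI[of _ "[]"]) auto
    qed
  qed
qed simp

text \<open>Coefficient of \<open>H\<close> in the bounds for each processor. Passing from
  \<open>j\<close> to \<open>j + 1\<close> costs \<open>2 * H\<close> for comparing two counts and
  \<open>(lam (j+1) + ell j) * D\<close>, where \<open>D = 2 * H / beta j\<close> bounds the time
  since the last message from \<open>j\<close>.\<close>

fun err :: "(nat \<Rightarrow> real) \<Rightarrow> (nat \<Rightarrow> real) \<Rightarrow> nat \<Rightarrow> real" where
  "err lam beta 0 = 1"
| "err lam beta (Suc 0) = 1"
| "err lam beta (Suc (Suc j)) = err lam beta (Suc j) + 2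
     + 2 * (lam (Suc (Suc j)) + ell lam (Suc j)) / beta (Suc j)"

text \<open>The list position \<open>i\<close> plays the role of time: up to an error \<open>H\<close>, each flow has produced
  its rate times \<open>T i\<close> points among the first \<open>i\<close> events.\<close>

locale regular_events =
  fixes N :: nat and lam beta :: "nat \<Rightarrow> real" and es :: "ev list" and T :: "nat \<Rightarrow> real" and H :: real
  assumes lam_pos: "\<And>k. k \<in> {1..N} \<Longrightarrow> lam k > 0"
    and beta_pos: "\<And>k. k \<in> {1..<N} \<Longrightarrow> beta k > 0"
    and events: "set es \<subseteq> set (flows N)"
    and T_nonneg: "\<And>i. i \<le> length es \<Longrightarrow> 0 \<le> T i"
    and T_mono: "\<And>i k. i \<le> k \<Longrightarrow> k \<le> length es \<Longrightarrow> T i \<le> T k"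
    and counts: "\<And>f i. f \<in> set (flows N) \<Longrightarrow> i \<le> length es \<Longrightarrow>
        \<bar>real (count_list (take i es) f) - rate lam beta f * T i\<bar> \<le> H"
begin

lemma count_Inc: "1 \<le> j \<Longrightarrow> j \<le> N \<Longrightarrow> i \<le> length es \<Longrightarrow>
    \<bar>real (count_list (take i es) (Inc j)) - lam j * T i\<bar> \<le> H"
  using counts[of "Inc j" i] by (simp add: rate_def in_flows_iff)

lemma count_Msg: "1 \<le> j \<Longrightarrow> j < N \<Longrightarrow> i \<le> length es \<Longrightarrow>
    \<bar>real (count_list (take i es) (Msg j)) - beta j * T i\<bar> \<le> H"
  using counts[of "Msg j" i] by (simp add: rate_def in_flows_iff)

lemma H_nonneg: "1 \<le> N \<Longrightarrow> 0 \<le> H"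
  using count_Inc[of 1 0] by linarith

lemma ell_pos': "1 \<le> j \<Longrightarrow> j \<le> N \<Longrightarrow> ell lam j > 0"
  using lam_pos by (intro ell_pos) auto

lemma err_ge: "1 \<le> j \<Longrightarrow> j \<le> N \<Longrightarrow> err lam beta j \<ge> 1"
proof (induction j rule: nat_induct_at_least)
  case (Suc j)
  then have "lam (Suc j) + ell lam j > 0" "beta j > 0"
    using lam_pos[of "Suc j"] ell_pos'[of j] beta_pos[of j] by auto
  then have "0 \<le> 2 * (lam (Suc j) + ell lam j) / beta j" by simp
  then show ?case using Suc by (cases j) auto
qed simp

lemma err_Suc: "1 \<le> j \<Longrightarrow> err lam beta (Suc j) = err lam beta j + 2 + 2 * (lam (Suc j) + ell lam j) / beta j"
  by (cases j) auto

text \<open>The counts of the suffix are natural-number differences; the last conclusion guarantees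
  that they are not truncated.\<close>

lemma split_take:
  assumes "take i es = ps @ fs" "i \<le> length es"
  obtains p where "p \<le> i" "p \<le> length es" "ps = take p es"
    "\<And>f. count_list fs f = count_list (take i es) f - count_list (take p es) f"
    "\<And>f. count_list (take p es) f \<le> count_list (take i es) f"
proof
  have len: "length ps + length fs = i"
    using arg_cong[OF assms(1), of length] assms(2) by simp
  then show "length ps \<le> i" "length ps \<le> length es" using assms(2) by auto
  have "take (length ps) (take i es) = ps" using assms(1) by simp
  then show ps: "ps = take (length ps) es" using len by (simp add: min_def split: if_splits)
  show "count_list fs f = count_list (take i es) f - count_list (take (length ps) es) f"
    "count_list (take (length ps) es) f \<le> count_list (take i es) f" for f
    unfolding ps[symmetric] assms(1) by auto
qed

text \<open>Processor \<open>j + 1\<close> obeys two upper bounds: its own increments give rate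
  \<open>lam (j+1)\<close>, and the predecessor at the last message gives rate \<open>ell j\<close>.
  Their minimum is \<open>ell (j+1)\<close>. The position \<open>i\<close> is generalised because
  the induction hypothesis is used at the earlier position \<open>p\<close>.\<close>

lemma crun_upper:
  assumes X: "\<And>k. k \<in> {1..N} \<Longrightarrow> \<bar>real_of_int (x0 k)\<bar> \<le> X"
    and "1 \<le> j" "j \<le> N" "i \<le> length es"
  shows "real_of_int (cx (crun N x0 (take i es)) j) \<le> ell lam j * T i + err lam beta j * H + X"
  using assms(2,3,4)
proof (induction j arbitrary: i rule: nat_induct_at_least)
  case base
  have "cx (crun N x0 (take i es)) 1 = x0 1 + int (count_list (take i es) (Inc 1))"
    by (rule crun_first) (use events set_take_subset[of i es] in blast)
  then show ?case
    using count_Inc[of 1 i] X[of 1] base by (simp add: ell_1)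
next
  case (Suc j)
  have H: "H \<ge> 0" using H_nonneg Suc by linarith
  have lam: "lam (Suc j) > 0" using lam_pos Suc by simp
  have ell: "ell lam j > 0" using ell_pos' Suc by simp
  have beta: "beta j > 0" using beta_pos Suc by simp
  let ?x = "\<lambda>i k. real_of_int (cx (crun N x0 (take i es)) k)"
  define D where "D = 2 * H / beta j"
  have D: "D \<ge> 0" using H beta by (simp add: D_def)
  have K: "err lam beta (Suc j) * H = err lam beta j * H + 2 * H + (lam (Suc j) + ell lam j) * D"
    using Suc.hyps beta by (simp add: err_Suc D_def field_simps)
  have K1: "err lam beta j * H \<ge> H" using err_ge[of j] Suc H by (simp add: mult_le_cancel_right1)
  have KD: "(lam (Suc j) + ell lam j) * D \<ge> 0" using lam ell D by simp
  have free: "?x i (Suc j) \<le> lam (Suc j) * T i + H + X"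
  proof -
    have "?x i (Suc j) \<le> x0 (Suc j) + count_list (take i es) (Inc (Suc j))"
      using crun_append_le[of N x0 "[]" "take i es" "Suc j"] by (simp add: crun_def)
    then show ?thesis
      using count_Inc[of "Suc j" i] X[of "Suc j"] Suc by simp
  qed
  have "?x i (Suc j) \<le> ell lam j * T i + err lam beta (Suc j) * H + X"
  proof -
    obtain ps fs where s: "take i es = ps @ fs" "count_list fs (Msg j) = 0"
      "ps = [] \<or> cx (crun N x0 ps) (Suc j) \<le> cx (crun N x0 ps) j"
      using crun_last_message[of j N "take i es" x0] Suc by auto
    obtain p where p: "p \<le> i" "p \<le> length es" "ps = take p es"
      "\<And>f. count_list fs f = count_list (take i es) f - count_list (take p es) f"
      "\<And>f. count_list (take p es) f \<le> count_list (take i es) f"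
      using split_take[OF s(1) \<open>i \<le> length es\<close>] by blast
    \<comment> \<open>Equal message counts at \<open>p\<close> and \<open>i\<close>, each within
      \<open>H\<close> of \<open>beta j\<close> times the elapsed time, force
      \<open>T i - T p \<le> D\<close>.\<close>
    have cm: "count_list (take i es) (Msg j) = count_list (take p es) (Msg j)"
      using p(4,5)[of "Msg j"] s(2) by simp
    show ?thesis
    proof (cases "ps = []")
      \<comment> \<open>No message so far: then \<open>T i\<close> itself is at most
        \<open>D\<close>, and the bound by own increments suffices.\<close>
      case True
      then have "beta j * T i \<le> H"
        using count_Msg[of j i] cm p(3)[symmetric] Suc.hyps Suc.prems by simp
      then have "T i \<le> D" using beta H by (simp add: D_def field_simps)
      then have "lam (Suc j) * T i \<le> lam (Suc j) * D" using lam by simp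
      moreover have "ell lam j * T i \<ge> 0" using ell T_nonneg[of i] Suc by simp
      moreover have "ell lam j * D \<ge> 0" using ell D by simp
      ultimately show ?thesis using free K K1 H by (simp add: algebra_simps)
    next
      case False
      have "beta j * T i - beta j * T p \<le> 2 * H"
        using count_Msg[of j i] count_Msg[of j p] cm p(2) Suc by simp
      then have TD: "T i - T p \<le> D" using beta by (simp add: D_def field_simps)
      have "?x i (Suc j) \<le> ?x p (Suc j) + (real (count_list (take i es) (Inc (Suc j))) - real (count_list (take p es) (Inc (Suc j))))"
        using crun_append_le[of N x0 ps fs "Suc j"] p(4,5)[of "Inc (Suc j)"]
        by (simp flip: s(1) p(3) add: of_nat_diff)
      also have "\<dots> \<le> ?x p j + (lam (Suc j) * (T i - T p) + 2 * H)"
        using s(3) False p(2,3) count_Inc[of "Suc j" i] count_Inc[of "Suc j" p] Suc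
        by (simp add: algebra_simps)
      also have "?x p j \<le> ell lam j * T p + err lam beta j * H + X"
        using Suc p(2) by simp
      also have "lam (Suc j) * (T i - T p) \<le> lam (Suc j) * D" using TD lam by simp
      finally have "?x i (Suc j) \<le> ell lam j * T p + err lam beta j * H + X + (lam (Suc j) * D + 2 * H)"
        by simp
      moreover have "ell lam j * T p \<le> ell lam j * T i"
        using ell T_mono[OF p(1)] Suc by simp
      moreover have "ell lam j * D \<ge> 0" using ell D by simp
      ultimately show ?thesis using K by (simp add: algebra_simps)
    qed
  qed
  moreover have "?x i (Suc j) \<le> lam (Suc j) * T i + err lam beta (Suc j) * H + X"
    using free K K1 KD H by linarith
  ultimately show ?case
    using Suc.hyps by (simp add: ell_Suc min_def)
qed

text \<open>Up to the last rollback position \<open>p\<close> the processor has gained at least what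
  its predecessor has, at rate \<open>ell j\<close>; from \<open>p\<close> on it grows at rate
  \<open>lam (j+1)\<close>. Both rates are at least \<open>ell (j+1)\<close>.\<close>

lemma crun_lower:
  assumes X: "\<And>k. k \<in> {1..N} \<Longrightarrow> \<bar>real_of_int (x0 k)\<bar> \<le> X"
    and "1 \<le> j" "j \<le> N" "i \<le> length es"
  shows "real_of_int (cx (crun N x0 (take i es)) j) \<ge> ell lam j * T i - err lam beta j * H - X"
  using assms(2,3,4)
proof (induction j arbitrary: i rule: nat_induct_at_least)
  case base
  have "cx (crun N x0 (take i es)) 1 = x0 1 + int (count_list (take i es) (Inc 1))"
    by (rule crun_first) (use events set_take_subset[of i es] in blast)
  then show ?case
    using count_Inc[of 1 i] X[of 1] base by (simp add: ell_1)
next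
  case (Suc j)
  have H: "H \<ge> 0" using H_nonneg Suc by linarith
  have ell: "ell lam (Suc j) \<le> ell lam j" "ell lam (Suc j) \<le> lam (Suc j)"
    using Suc.hyps by (auto simp: ell_Suc)
  let ?x = "\<lambda>i k. real_of_int (cx (crun N x0 (take i es)) k)"
  have K: "err lam beta (Suc j) * H \<ge> err lam beta j * H + 2 * H"
  proof -
    have "2 * (lam (Suc j) + ell lam j) / beta j \<ge> 0"
      using lam_pos[of "Suc j"] ell_pos'[of j] beta_pos[of j] Suc by simp
    then have "err lam beta (Suc j) \<ge> err lam beta j + 2"
      using Suc.hyps unfolding err_Suc[OF Suc.hyps] by linarith
    then show ?thesis using H by (metis distrib_right mult_right_mono)
  qed
  have K1: "err lam beta j * H \<ge> H" using err_ge[of j] Suc H by (simp add: mult_le_cancel_right1)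
  obtain ps fs where s: "take i es = ps @ fs"
      "cx (crun N x0 (take i es)) (Suc j) = cx (crun N x0 ps) (Suc j) + int (count_list fs (Inc (Suc j)))"
      "ps = [] \<or> cx (crun N x0 ps) j \<le> cx (crun N x0 ps) (Suc j)"
    using crun_last_rollback by blast
  obtain p where p: "p \<le> i" "p \<le> length es" "ps = take p es"
      "\<And>f. count_list fs f = count_list (take i es) f - count_list (take p es) f"
      "\<And>f. count_list (take p es) f \<le> count_list (take i es) f"
    using split_take[OF s(1) \<open>i \<le> length es\<close>] by blast
  show ?case
  proof (cases "ps = []")
    case True
    have "?x i (Suc j) = x0 (Suc j) + count_list (take i es) (Inc (Suc j))"
      using s True by (simp add: crun_def)
    then have "?x i (Suc j) \<ge> lam (Suc j) * T i - H - X"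
      using count_Inc[of "Suc j" i] X[of "Suc j"] Suc by simp
    moreover have "ell lam (Suc j) * T i \<le> lam (Suc j) * T i"
      using ell T_nonneg[of i] Suc by (simp add: mult_right_mono)
    ultimately show ?thesis using K K1 H by linarith
  next
    case False
    have eq: "?x i (Suc j) = ?x p (Suc j) + (real (count_list (take i es) (Inc (Suc j))) - real (count_list (take p es) (Inc (Suc j))))"
      using s(2) p(4,5)[of "Inc (Suc j)"] by (simp flip: p(3) add: of_nat_diff)
    have "ell lam (Suc j) * T i = ell lam (Suc j) * T p + ell lam (Suc j) * (T i - T p)"
      by (simp add: algebra_simps)
    also have "\<dots> \<le> ell lam j * T p + lam (Suc j) * (T i - T p)"
      using ell T_nonneg[of p] T_mono[OF p(1)] Suc p(2) by (intro add_mono mult_right_mono) auto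
    also have "ell lam j * T p \<le> ?x p j + err lam beta j * H + X"
      using Suc.IH[OF Suc_leD[OF Suc.prems(1)] p(2)] by linarith
    also have "?x p j \<le> ?x p (Suc j)" using s(3) False p(3) by simp
    finally have "ell lam (Suc j) * T i \<le> ?x p (Suc j) + err lam beta j * H + X + lam (Suc j) * (T i - T p)"
      by simp
    then show ?thesis
      using eq count_Inc[of "Suc j" i] count_Inc[of "Suc j" p] Suc.prems p(2) K
      by (simp add: algebra_simps)
  qed
qed

end

section \<open>Measurability of the process in the inter-arrival times\<close>

section \<open>Measurability\<close>


instance ev :: countable
  by countable_datatype

text \<open>The sample point enters only through finitely many comparisons of measurable
  keys.\<close>

lemma measurable_insort_key:
  fixes k :: "'a \<Rightarrow> 'w \<Rightarrow> real"
  assumes [measurable]: "\<And>x. k x \<in> borel_measurable M"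
  shows "(\<lambda>\<omega>. insort_key (\<lambda>x. k x \<omega>) x ys) \<in> measurable M (count_space UNIV)"
proof (induction ys)
  case (Cons y ys)
  have "(\<lambda>\<omega>. y # insort_key (\<lambda>x. k x \<omega>) x ys) \<in> measurable M (count_space UNIV)"
    by (rule measurable_compose[OF Cons]) simp
  then show ?case by simp
qed simp

text \<open>The sorted tail takes values in a countable set of lists, so insertion can be treated
  separately for each of its values.\<close>

lemma measurable_sort_key:
  fixes k :: "'a::countable \<Rightarrow> 'w \<Rightarrow> real"
  assumes "\<And>x. k x \<in> borel_measurable M"
  shows "(\<lambda>\<omega>. sort_key (\<lambda>x. k x \<omega>) xs) \<in> measurable M (count_space UNIV)"
proof (induction xs)
  case (Cons x xs)
  show ?case
    using measurable_compose_countable[OF measurable_insort_key[of k M x, OF assms] Cons] by simp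
qed simp

lemma insort_key_map: "insort_key h (g x) (map g ys) = map g (insort_key (h \<circ> g) x ys)"
  by (induction ys) auto

lemma sort_key_map: "sort_key h (map g xs) = map g (sort_key (h \<circ> g) xs)"
  by (induction xs) (auto simp: insort_key_map comp_def)

lemma measurable_map_list:
  fixes g :: "'a \<Rightarrow> 'w \<Rightarrow> 'b::countable"
  assumes "\<And>x. x \<in> set xs \<Longrightarrow> g x \<in> measurable M (count_space UNIV)"
  shows "(\<lambda>\<omega>. map (\<lambda>x. g x \<omega>) xs) \<in> measurable M (count_space UNIV)"
  using assms
proof (induction xs)
  case (Cons x xs)
  have "(\<lambda>\<omega>. g x \<omega> # map (\<lambda>x. g x \<omega>) xs) \<in> measurable M (count_space UNIV)"
    by (rule measurable_compose_countable[where f = "\<lambda>a \<omega>. a # map (\<lambda>x. g x \<omega>) xs"])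
       (use Cons in \<open>auto intro: measurable_compose[where g = "(#) _"]\<close>)
  then show ?case by simp
qed simp

lemma measurable_coordinate:
  "f \<in> set (flows N) \<Longrightarrow> (\<lambda>\<omega>. \<omega> (f, i)) \<in> borel_measurable (cascade_space N lam beta)"
  using measurable_component_singleton[of "(f, i)" "set (flows N) \<times> UNIV"
      "\<lambda>(f, i). density lborel (exponential_density (rate lam beta f))"]
  by (simp add: cascade_space_def cong: measurable_cong_sets)

lemma measurable_arrival:
  "f \<in> set (flows N) \<Longrightarrow> (\<lambda>\<omega>. arrival \<omega> f m) \<in> borel_measurable (cascade_space N lam beta)"
  unfolding arrival_def by (intro borel_measurable_sum measurable_coordinate)

text \<open>Separates the two ways in which randomness enters: the unsorted list depends on the
  sample point only through the vector of point counts, and the rest sits in the sorting keys. The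
  guard in the key makes it measurable for every pair, also outside the flows.\<close>

lemma events_upto_eq:
  "events_upto N \<omega> t = map fst (sort_key (\<lambda>(f, m). if f \<in> set (flows N) then arrival \<omega> f m else 0)
     (concat (map (\<lambda>(f, n). map (Pair f) [0..<n]) (zip (flows N) (map (\<lambda>f. npoints \<omega> f t) (flows N))))))"
proof -
  let ?g = "\<lambda>(f, m). (if f \<in> set (flows N) then arrival \<omega> f m else 0, f)"
  let ?L = "concat (map (\<lambda>f. map (Pair f) [0..<npoints \<omega> f t]) (flows N))"
  have 1: "concat (map (\<lambda>f. map (\<lambda>m. (arrival \<omega> f m, f)) [0..<npoints \<omega> f t]) (flows N)) = map ?g ?L"
    by (auto simp: map_concat comp_def intro!: arg_cong[where f = concat])
  have 2: "fst \<circ> ?g = (\<lambda>(f, m). if f \<in> set (flows N) then arrival \<omega> f m else 0)" "snd \<circ> ?g = fst"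
    by auto
  have 3: "?L = concat (map (\<lambda>(f, n). map (Pair f) [0..<n]) (zip (flows N) (map (\<lambda>f. npoints \<omega> f t) (flows N))))"
    by (simp add: zip_map2 zip_same_conv_map comp_def)
  show ?thesis
    unfolding events_upto_def 1 sort_key_map map_map 2 unfolding 3 ..
qed

lemma measurable_xproc:
  "(\<lambda>\<omega>. xproc N x0 \<omega> t j) \<in> measurable (cascade_space N lam beta) (count_space UNIV)"
proof -
  let ?M = "cascade_space N lam beta"
  have np: "(\<lambda>\<omega>. map (\<lambda>f. npoints \<omega> f t) (flows N)) \<in> measurable ?M (count_space UNIV)"
  proof (rule measurable_map_list)
    fix f assume "f \<in> set (flows N)"
    note [measurable] = measurable_arrival[OF this, of _ lam beta]
    show "(\<lambda>\<omega>. npoints \<omega> f t) \<in> measurable ?M (count_space UNIV)"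
      unfolding npoints_def by measurable
  qed
  have key: "(\<lambda>\<omega>. case x of (f, m) \<Rightarrow> if f \<in> set (flows N) then arrival \<omega> f m else 0) \<in> borel_measurable ?M" for x
    by (cases x; cases "fst x \<in> set (flows N)") (simp_all add: measurable_arrival)
  have "(\<lambda>\<omega>. events_upto N \<omega> t) \<in> measurable ?M (count_space UNIV)"
    unfolding events_upto_eq
    by (rule measurable_compose[OF measurable_compose_countable[OF measurable_sort_key[OF key] np]]) simp
  then show ?thesis
    unfolding xproc_def by (rule measurable_compose) simp
qed

section \<open>Time stamps in the sorted event list and the counts of its prefixes\<close>

section \<open>From Poisson flows to event lists\<close>


lemma distinct_flows: "distinct (flows N)"
  by (auto simp: flows_def distinct_map inj_on_def)

lemma rate_pos:
  assumes "\<forall>k\<in>{1..N}. lam k > 0" "\<forall>k\<in>{1..<N}. beta k > 0" "f \<in> set (flows N)"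
  shows "rate lam beta f > 0"
  using assms by (auto simp: rate_def in_flows_iff)

lemma count_list_map_snd: "count_list (map snd xs) f = length (filter (\<lambda>p. snd p = f) xs)"
  by (induction xs) auto

lemma length_filter_mono: "(\<And>x. P x \<Longrightarrow> Q x) \<Longrightarrow> length (filter P xs) \<le> length (filter Q xs)"
  by (induction xs) (auto intro: le_SucI)

text \<open>The first \<open>i\<close> entries contain every point before the time \<open>s\<close>
  of the last of them and none after \<open>s\<close>. Points tied at \<open>s\<close> may fall on
  either side, hence a strict and a non-strict count.\<close>

lemma sorted_count_bounds:
  assumes sorted: "sorted (map fst L)" and i: "0 < i" "i \<le> length L"
  defines "s \<equiv> fst (L ! (i - 1))"
  shows "length (filter (\<lambda>p. snd p = f \<and> fst p < s) L) \<le> count_list (take i (map snd L)) f"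
    and "count_list (take i (map snd L)) f \<le> length (filter (\<lambda>p. snd p = f \<and> fst p \<le> s) L)"
proof -
  have le: "fst (L ! a) \<le> fst (L ! b)" if "a \<le> b" "b < length L" for a b
    using sorted_nth_mono[OF sorted, of a b] that by simp
  have cl: "count_list (take i (map snd L)) f = length (filter (\<lambda>p. snd p = f) (take i L))"
    by (simp add: take_map count_list_map_snd)
  have app: "L = take i L @ drop i L" by simp
  have "filter (\<lambda>p. snd p = f \<and> fst p < s) (drop i L) = []"
  proof -
    have "s \<le> fst p" if "p \<in> set (drop i L)" for p
      using that le[of "i - 1"] i unfolding s_def by (auto simp: in_set_conv_nth simp del: One_nat_def)
    then show ?thesis by (auto simp: filter_empty_conv simp flip: not_le)
  qed
  then have "length (filter (\<lambda>p. snd p = f \<and> fst p < s) L)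
      = length (filter (\<lambda>p. snd p = f \<and> fst p < s) (take i L))"
    by (subst app) (simp only: filter_append append_Nil2)
  also have "\<dots> \<le> length (filter (\<lambda>p. snd p = f) (take i L))"
    by (rule length_filter_mono) simp
  finally show "length (filter (\<lambda>p. snd p = f \<and> fst p < s) L) \<le> count_list (take i (map snd L)) f"
    unfolding cl .
  have "fst p \<le> s" if "p \<in> set (take i L)" for p
    using that le[of _ "i - 1"] i by (auto simp: in_set_conv_nth s_def)
  then have "filter (\<lambda>p. snd p = f) (take i L) = filter (\<lambda>p. snd p = f \<and> fst p \<le> s) (take i L)"
    by (intro filter_cong) auto
  then show "count_list (take i (map snd L)) f \<le> length (filter (\<lambda>p. snd p = f \<and> fst p \<le> s) L)"
    unfolding cl by (subst (2) app) (simp only: filter_append length_append le_add1)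
qed

definition timed_events :: "nat \<Rightarrow> (ev \<times> nat \<Rightarrow> real) \<Rightarrow> real \<Rightarrow> (real \<times> ev) list" where
  "timed_events N \<omega> t = sort_key fst
      (concat (map (\<lambda>f. map (\<lambda>m. (arrival \<omega> f m, f)) [0..<npoints \<omega> f t]) (flows N)))"

lemma events_upto_timed: "events_upto N \<omega> t = map snd (timed_events N \<omega> t)"
  by (simp add: events_upto_def timed_events_def)

text \<open>Sorting preserves the multiset, and as the flows are distinct only the block of
  \<open>f\<close> contributes.\<close>

lemma length_filter_timed_events:
  assumes "f \<in> set (flows N)"
  shows "length (filter (\<lambda>p. snd p = f \<and> P (fst p)) (timed_events N \<omega> t))
    = card {m. m < npoints \<omega> f t \<and> P (arrival \<omega> f m)}"
proof -
  let ?Q = "\<lambda>p. snd p = f \<and> P (fst p)"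
  let ?xs = "\<lambda>f. map (\<lambda>m. (arrival \<omega> f m, f)) [0..<npoints \<omega> f t]"
  have len: "length (filter ?Q (?xs g)) = (if g = f then card {m. m < npoints \<omega> f t \<and> P (arrival \<omega> f m)} else 0)" for g
    by (auto simp: filter_map comp_def length_filter_conv_card intro!: arg_cong[where f = card])
  have "length (filter ?Q (timed_events N \<omega> t)) = length (filter ?Q (concat (map ?xs (flows N))))"
    unfolding timed_events_def size_mset[symmetric] mset_filter mset_sort ..
  also have "\<dots> = (\<Sum>g\<leftarrow>flows N. length (filter ?Q (?xs g)))"
    by (simp add: filter_concat length_concat comp_def)
  also have "\<dots> = (\<Sum>g\<in>set (flows N). length (filter ?Q (?xs g)))"
    by (rule sum_list_distinct_conv_sum_set[OF distinct_flows])
  also have "\<dots> = card {m. m < npoints \<omega> f t \<and> P (arrival \<omega> f m)}"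
    unfolding len using assms by simp
  finally show ?thesis .
qed

lemma set_timed_events:
  "set (timed_events N \<omega> t) = {(arrival \<omega> f m, f) |f m. f \<in> set (flows N) \<and> m < npoints \<omega> f t}"
  by (auto simp: timed_events_def)

text \<open>The upper bound includes points at \<open>s\<close> and the lower bound excludes them,
  so the order of ties in the event list cannot matter. Finiteness keeps \<open>card\<close> away
  from its default value 0.\<close>

definition regular_flow :: "(ev \<times> nat \<Rightarrow> real) \<Rightarrow> ev \<Rightarrow> real \<Rightarrow> real \<Rightarrow> real \<Rightarrow> bool" where
  "regular_flow \<omega> f r t H \<longleftrightarrow> (\<forall>i. 0 \<le> \<omega> (f, i)) \<and> finite {m. arrival \<omega> f m \<le> t} \<and>
     (\<forall>s\<in>{0..t}. real (card {m. arrival \<omega> f m \<le> s}) \<le> r * s + H \<and>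
                 r * s - H \<le> real (card {m. arrival \<omega> f m < s}))"

lemma arrival_mono: "(\<And>i. 0 \<le> \<omega> (f, i)) \<Longrightarrow> m \<le> n \<Longrightarrow> arrival \<omega> f m \<le> arrival \<omega> f n"
  unfolding arrival_def by (intro sum_mono2) auto

text \<open>With nonnegative gaps the arrivals up to \<open>t\<close> form an initial segment of the
  indices, whose length is its cardinality.\<close>

lemma less_npoints_iff:
  assumes nn: "\<And>i. 0 \<le> \<omega> (f, i)" and fin: "finite {m. arrival \<omega> f m \<le> t}"
  shows "m < npoints \<omega> f t \<longleftrightarrow> arrival \<omega> f m \<le> t"
proof
  assume "arrival \<omega> f m \<le> t"
  then have "{..m} \<subseteq> {m. arrival \<omega> f m \<le> t}"
    using arrival_mono[of \<omega> f, OF nn] by (auto intro: order_trans)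
  then have "card {..m} \<le> npoints \<omega> f t" unfolding npoints_def by (intro card_mono fin)
  then show "m < npoints \<omega> f t" by simp
next
  assume m: "m < npoints \<omega> f t"
  show "arrival \<omega> f m \<le> t"
  proof (rule ccontr)
    assume "\<not> arrival \<omega> f m \<le> t"
    then have "n < m" if "arrival \<omega> f n \<le> t" for n
      using arrival_mono[of \<omega> f m n, OF nn] that by linarith
    then have "{m. arrival \<omega> f m \<le> t} \<subseteq> {..<m}" by blast
    then have "npoints \<omega> f t \<le> card {..<m}" unfolding npoints_def by (intro card_mono) auto
    with m show False by simp
  qed
qed

lemma regular_events_upto:
  assumes lam_pos: "\<forall>k\<in>{1..N}. lam k > 0" and beta_pos: "\<forall>k\<in>{1..<N}. beta k > 0"
    and reg: "\<And>f. f \<in> set (flows N) \<Longrightarrow> regular_flow \<omega> f (rate lam beta f) t H"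
    and t: "0 \<le> t"
  shows "\<exists>T. T (length (events_upto N \<omega> t)) = t \<and> regular_events N lam beta (events_upto N \<omega> t) T H"
proof -
  define L where "L = timed_events N \<omega> t"
  \<comment> \<open>Position \<open>i\<close> gets the time of its last event, except that the full
    list gets the observation time \<open>t\<close> itself, also when it is empty.\<close>
  define T where "T i = (if i = length L then t else if i = 0 then 0 else fst (L ! (i - 1)))" for i
  have nn: "0 \<le> \<omega> (f, i)" if "f \<in> set (flows N)" for f i
    using reg[OF that] by (auto simp: regular_flow_def)
  have fin: "finite {m. arrival \<omega> f m \<le> t}" if "f \<in> set (flows N)" for f
    using reg[OF that] by (auto simp: regular_flow_def)
  have np: "m < npoints \<omega> f t \<longleftrightarrow> arrival \<omega> f m \<le> t" if "f \<in> set (flows N)" for f m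
    by (rule less_npoints_iff[OF nn[OF that] fin[OF that]])
  have sorted: "sorted (map fst L)" by (simp add: L_def timed_events_def)
  have L_bounds: "0 \<le> fst (L ! i)" "fst (L ! i) \<le> t" if "i < length L" for i
  proof -
    obtain f m where "L ! i = (arrival \<omega> f m, f)" "f \<in> set (flows N)" "m < npoints \<omega> f t"
      using nth_mem[OF \<open>i < length L\<close>] unfolding L_def set_timed_events by blast
    then show "0 \<le> fst (L ! i)" "fst (L ! i) \<le> t"
      using nn np by (auto simp: arrival_def sum_nonneg)
  qed
  have T_bounds: "0 \<le> T i" "T i \<le> t" if "i \<le> length L" for i
    using that L_bounds[of "i - 1"] t by (auto simp: T_def)
  have T_mono: "T i \<le> T k" if "i \<le> k" "k \<le> length L" for i k
  proof (cases "k = length L \<or> i = 0")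
    case True
    then show ?thesis using T_bounds[of i] T_bounds[of k] that by (auto simp: T_def)
  next
    case False
    then show ?thesis
      using that sorted_nth_mono[OF sorted, of "i - 1" "k - 1"] by (auto simp: T_def)
  qed
  have counts: "\<bar>real (count_list (take i (map snd L)) f) - rate lam beta f * T i\<bar> \<le> H"
    if f: "f \<in> set (flows N)" and i: "i \<le> length L" for f i
  proof -
    let ?r = "rate lam beta f"
    have up: "real (card {m. arrival \<omega> f m \<le> s}) \<le> ?r * s + H"
      and lo: "?r * s - H \<le> real (card {m. arrival \<omega> f m < s})" if "0 \<le> s" "s \<le> t" for s
      using reg[OF f] that by (auto simp: regular_flow_def)
    have fin_le: "finite {m. arrival \<omega> f m \<le> s}" if "s \<le> t" for s
      using that by (intro finite_subset[OF _ fin[OF f]]) auto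
    consider "i = length L" | "i = 0" "i < length L" | "0 < i" "i < length L" using i by linarith
    then show ?thesis
    proof cases
      case 1
      have "count_list (map snd L) f = card {m. arrival \<omega> f m \<le> t}"
        using length_filter_timed_events[OF f, of "\<lambda>_. True" \<omega> t] np[OF f]
        by (simp add: count_list_map_snd flip: L_def)
      moreover have "card {m. arrival \<omega> f m < t} \<le> card {m. arrival \<omega> f m \<le> t}"
        by (intro card_mono fin_le) auto
      ultimately show ?thesis
        using up[of t] lo[of t] t 1 by (simp add: T_def)
    next
      case 2
      then show ?thesis using up[of 0] lo[of 0] t by (simp add: T_def)
    next
      case 3
      define s where "s = fst (L ! (i - 1))"
      have s: "T i = s" "0 \<le> s" "s \<le> t" using 3 L_bounds[of "i - 1"] by (auto simp: T_def s_def)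
      have "card {m. arrival \<omega> f m < s} \<le> count_list (take i (map snd L)) f"
      proof -
        have "{m. arrival \<omega> f m < s} = {m. m < npoints \<omega> f t \<and> arrival \<omega> f m < s}"
          unfolding np[OF f] using s(3) by auto
        then show ?thesis
          using sorted_count_bounds(1)[OF sorted, of i f] 3
            length_filter_timed_events[OF f, of "\<lambda>a. a < s" \<omega> t] by (simp add: s_def flip: L_def)
      qed
      moreover have "count_list (take i (map snd L)) f \<le> card {m. arrival \<omega> f m \<le> s}"
      proof -
        have "{m. arrival \<omega> f m \<le> s} = {m. m < npoints \<omega> f t \<and> arrival \<omega> f m \<le> s}"
          unfolding np[OF f] using s(3) by auto
        then show ?thesis
          using sorted_count_bounds(2)[OF sorted, of i f] 3
            length_filter_timed_events[OF f, of "\<lambda>a. a \<le> s" \<omega> t] by (simp add: s_def flip: L_def)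
      qed
      ultimately show ?thesis using up[OF s(2,3)] lo[OF s(2,3)] unfolding s(1) by linarith
    qed
  qed
  have ev: "events_upto N \<omega> t = map snd L" by (simp add: events_upto_timed L_def)
  have "regular_events N lam beta (map snd L) T H"
  proof
    show "set (map snd L) \<subseteq> set (flows N)"
      unfolding L_def set_map set_timed_events by auto
  qed (use lam_pos beta_pos T_bounds T_mono counts in auto)
  then show ?thesis
    unfolding ev by (intro exI[of _ T]) (simp add: T_def)
qed

section \<open>Uniform closeness of the counting functions to their means\<close>

section \<open>Law of large numbers for the flows\<close>


lemma grid_point:
  fixes y h :: real
  assumes "h \<ge> 1" "y \<ge> 0" "y / h + 3 \<le> real G"
  obtains g where "g \<le> G" "y \<le> real (nat \<lfloor>real g * h\<rfloor>)" "real (nat \<lfloor>real g * h\<rfloor>) \<le> y + 2 * h"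
proof
  \<comment> \<open>The added 1 absorbs the rounding down of \<open>g * h\<close>; rounding up to a
    grid index costs at most one further \<open>h\<close>.\<close>
  define g where "g = nat \<lceil>(y + 1) / h\<rceil>"
  have pos: "0 \<le> (y + 1) / h" using assms by simp
  have g: "(y + 1) / h \<le> real g" "real g \<le> (y + 1) / h + 1"
    using pos unfolding g_def by linarith+
  have "1 / h \<le> 1" using assms by simp
  then have "real g \<le> y / h + 2" using g(2) by (simp add: add_divide_distrib)
  then show "g \<le> G" using assms(3) by linarith
  have "y + 1 \<le> real g * h" "real g * h \<le> y + 1 + h"
    using g assms(1) by (simp_all add: field_simps)
  then show "y \<le> real (nat \<lfloor>real g * h\<rfloor>)" "real (nat \<lfloor>real g * h\<rfloor>) \<le> y + 2 * h"
    using assms by linarith+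
qed

text \<open>Indexed by the number of gaps, so that \<open>psum\<close> at 0 is 0 and the mean at
  \<open>m\<close> is \<open>m / r\<close>; \<open>arrival\<close> is shifted by one.\<close>

definition psum :: "(ev \<times> nat \<Rightarrow> real) \<Rightarrow> ev \<Rightarrow> nat \<Rightarrow> real" where
  "psum \<omega> f m = (\<Sum>i<m. \<omega> (f, i))"

lemma arrival_eq_psum: "arrival \<omega> f m = psum \<omega> f (Suc m)"
  by (simp add: arrival_def psum_def lessThan_Suc_atMost)

lemma psum_mono: "(\<And>i. 0 \<le> \<omega> (f, i)) \<Longrightarrow> m \<le> n \<Longrightarrow> psum \<omega> f m \<le> psum \<omega> f n"
  unfolding psum_def by (intro sum_mono2) auto

text \<open>Monotonicity of the partial sums upgrades the law of large numbers on a finite grid of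
  indices to a bound that is uniform in time.\<close>

lemma regular_flow_of_grid:
  fixes r \<eta> t :: real
  assumes nn: "\<And>i. 0 \<le> \<omega> (f, i)" and r: "0 < r" and \<eta>: "0 < \<eta>" and t: "1 \<le> \<eta> * t / 4"
    and G: "4 * (r + \<eta>) / \<eta> + 3 \<le> real G"
    and grid: "\<And>g m. g \<le> G \<Longrightarrow> m = nat \<lfloor>real g * (\<eta> * t / 4)\<rfloor> \<Longrightarrow>
       \<bar>psum \<omega> f m - real m / r\<bar> < \<eta> / (4 * r) * t"
  shows "regular_flow \<omega> f r t (\<eta> * t)"
proof -
  have "0 < \<eta> * t" using t by linarith
  then have t0: "0 < t" using \<eta> by (simp add: zero_less_mult_iff)
  \<comment> \<open>The grid has spacing \<open>\<eta> * t / 4\<close> and \<open>grid_point\<close>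
    overshoots by at most two spacings, which gives the \<open>\<eta> * t / 2\<close>.\<close>
  have pt: "\<exists>m. y \<le> real m \<and> real m \<le> y + \<eta> * t / 2 \<and> \<bar>psum \<omega> f m - real m / r\<bar> < \<eta> / (4 * r) * t"
    if y: "0 \<le> y" "y \<le> (r + \<eta>) * t" for y
  proof -
    have "y / (\<eta> * t / 4) \<le> (r + \<eta>) * t / (\<eta> * t / 4)"
      using y t by (intro divide_right_mono) auto
    also have "\<dots> = 4 * (r + \<eta>) / \<eta>" using t0 \<eta> by (simp add: field_simps)
    finally have "y / (\<eta> * t / 4) + 3 \<le> real G" using G by simp
    then obtain g where g: "g \<le> G" "y \<le> real (nat \<lfloor>real g * (\<eta> * t / 4)\<rfloor>)"
        "real (nat \<lfloor>real g * (\<eta> * t / 4)\<rfloor>) \<le> y + 2 * (\<eta> * t / 4)"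
      using grid_point[OF t y(1)] by blast
    define m where "m = nat \<lfloor>real g * (\<eta> * t / 4)\<rfloor>"
    show ?thesis
      using grid[OF g(1) m_def] g(2,3)[folded m_def] by (intro exI[of _ m]) auto
  qed
  \<comment> \<open>Aim at \<open>r * s + \<eta> * t / 2\<close>: the mean of \<open>psum\<close>
    there exceeds \<open>s\<close> by \<open>\<eta> * t / (2 * r)\<close>, twice the allowed
    deviation, so fewer than \<open>m + 1\<close> points fall in the interval up to
    \<open>s\<close>.\<close>
  have up: "\<exists>m. {n. arrival \<omega> f n \<le> s} \<subseteq> {..<m} \<and> real m \<le> r * s + \<eta> * t" if s: "0 \<le> s" "s \<le> t" for s
  proof -
    have "r * s \<le> r * t" "0 \<le> r * s" "0 \<le> \<eta> * t" using s r \<eta> t0 by auto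
    then have "0 \<le> r * s + \<eta> * t / 2" "r * s + \<eta> * t / 2 \<le> (r + \<eta>) * t"
      unfolding distrib_right by linarith+
    from pt[OF this] obtain m where m: "r * s + \<eta> * t / 2 \<le> real m" "real m \<le> r * s + \<eta> * t / 2 + \<eta> * t / 2"
        "\<bar>psum \<omega> f m - real m / r\<bar> < \<eta> / (4 * r) * t"
      by blast
    have "s + \<eta> / (2 * r) * t \<le> real m / r" using divide_right_mono[OF m(1), of r] r by (simp add: add_divide_distrib mult.commute)
    moreover have "\<eta> / (4 * r) * t \<le> \<eta> / (2 * r) * t" using \<eta> r t0 by (simp add: field_simps)
    ultimately have "s < psum \<omega> f m" using m(3) by linarith
    then have "n < m" if "arrival \<omega> f n \<le> s" for n
      using psum_mono[of \<omega> f m "Suc n", OF nn] that unfolding arrival_eq_psum by linarith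
    then show ?thesis using m(2) by (intro exI[of _ m]) auto
  qed
  \<comment> \<open>Aim at \<open>r * s - \<eta> * t\<close>: even after the overshoot the mean
    stays below \<open>s\<close> by \<open>\<eta> * t / (2 * r)\<close>. If the target is not
    positive, \<open>m = 0\<close> will do.\<close>
  have lo: "\<exists>m. {..<m} \<subseteq> {n. arrival \<omega> f n < s} \<and> r * s - \<eta> * t \<le> real m" if s: "0 \<le> s" "s \<le> t" for s
  proof (cases "r * s - \<eta> * t \<le> 0")
    case True
    then show ?thesis by (intro exI[of _ 0]) auto
  next
    case False
    have "r * s \<le> r * t" "0 \<le> \<eta> * t" using s r \<eta> t0 by auto
    then obtain m where m: "r * s - \<eta> * t \<le> real m" "real m \<le> r * s - \<eta> * t + \<eta> * t / 2"
        "\<bar>psum \<omega> f m - real m / r\<bar> < \<eta> / (4 * r) * t"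
      using pt[of "r * s - \<eta> * t"] False by (auto simp: algebra_simps)
    have "real m / r \<le> s - \<eta> / (2 * r) * t" using divide_right_mono[OF m(2), of r] r by (simp add: add_divide_distrib diff_divide_distrib mult.commute)
    moreover have "\<eta> / (4 * r) * t \<le> \<eta> / (2 * r) * t" using \<eta> r t0 by (simp add: field_simps)
    ultimately have "psum \<omega> f m < s" using m(3) by linarith
    then have "arrival \<omega> f n < s" if "n < m" for n
      using psum_mono[of \<omega> f "Suc n" m, OF nn] that unfolding arrival_eq_psum by linarith
    then show ?thesis using m(1) by (intro exI[of _ m]) auto
  qed
  have fin: "finite {n. arrival \<omega> f n \<le> t}"
    using up[of t] t0 finite_subset[OF _ finite_lessThan] by auto
  have "real (card {n. arrival \<omega> f n \<le> s}) \<le> r * s + \<eta> * t" if s: "0 \<le> s" "s \<le> t" for s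
  proof -
    obtain m where m: "{n. arrival \<omega> f n \<le> s} \<subseteq> {..<m}" "real m \<le> r * s + \<eta> * t" using up[OF s] by blast
    from card_mono[OF _ m(1)] have "card {n. arrival \<omega> f n \<le> s} \<le> m" by simp
    with m(2) show ?thesis by linarith
  qed
  moreover have "r * s - \<eta> * t \<le> real (card {n. arrival \<omega> f n < s})" if s: "0 \<le> s" "s \<le> t" for s
  proof -
    obtain m where m: "{..<m} \<subseteq> {n. arrival \<omega> f n < s}" "r * s - \<eta> * t \<le> real m" using lo[OF s] by blast
    have "finite {n. arrival \<omega> f n < s}" by (rule finite_subset[OF _ fin]) (use s in auto)
    from card_mono[OF this m(1)] have "m \<le> card {n. arrival \<omega> f n < s}" by simp
    with m(2) show ?thesis by linarith
  qed
  ultimately show ?thesis using nn fin by (simp add: regular_flow_def)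
qed

section \<open>Chebyshev estimates for the flows and convergence in probability\<close>

context
  fixes N :: nat and lam beta :: "nat \<Rightarrow> real"
  assumes lam_pos: "\<forall>k\<in>{1..N}. lam k > 0" and beta_pos: "\<forall>k\<in>{1..<N}. beta k > 0"
begin

abbreviation (input) "CS \<equiv> cascade_space N lam beta"
abbreviation (input) "EXPD \<equiv> (\<lambda>(f::ev, i::nat). density lborel (exponential_density (rate lam beta f)))"

lemma prob_space_component: "x \<in> set (flows N) \<times> UNIV \<Longrightarrow> prob_space (EXPD x)"
  using rate_pos[OF lam_pos beta_pos] by (auto intro!: prob_space_exponential_density)

lemma prob_space_cascade_space: "prob_space CS"
  unfolding cascade_space_def by (intro prob_space_PiM prob_space_component)

lemma distributed_coordinate:
  assumes "f \<in> set (flows N)"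
  shows "distributed CS lborel (\<lambda>\<omega>. \<omega> (f, i)) (exponential_density (rate lam beta f))"
proof -
  have "distr CS (EXPD (f, i)) (\<lambda>\<omega>. \<omega> (f, i)) = EXPD (f, i)"
    unfolding cascade_space_def using assms
    by (intro distr_PiM_component prob_space_component) auto
  moreover have "distr CS (EXPD (f, i)) (\<lambda>\<omega>. \<omega> (f, i)) = distr CS lborel (\<lambda>\<omega>. \<omega> (f, i))"
    by (intro distr_cong) auto
  ultimately show ?thesis
    using measurable_coordinate[OF assms] by (simp add: distributed_def)
qed

lemma AE_coordinate_nonneg: "AE \<omega> in CS. \<forall>f\<in>set (flows N). \<forall>i. 0 \<le> \<omega> (f, i)"
proof -
  have "AE \<omega> in CS. 0 \<le> \<omega> (f, i)" if f: "f \<in> set (flows N)" for f i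
  proof -
    have "AE x in EXPD (f, i). 0 \<le> x"
      by (auto simp: AE_density exponential_density_def erlang_density_def)
    then show ?thesis
      unfolding cascade_space_def using f
      by (intro AE_PiM_component prob_space_component) auto
  qed
  then show ?thesis by (simp add: AE_all_countable AE_finite_all)
qed

text \<open>Reindexing the product measure along \<open>i\<close> to \<open>(f, i)\<close> shows
  that the joint law of the gaps of one flow is the product of their marginals.\<close>

lemma indep_coordinates:
  assumes "f \<in> set (flows N)"
  shows "prob_space.indep_vars CS (\<lambda>_. borel) (\<lambda>i \<omega>. \<omega> (f, i)) UNIV"
proof -
  interpret prob_space CS by (rule prob_space_cascade_space)
  let ?D = "density lborel (exponential_density (rate lam beta f)) :: real measure"
  have D: "distr CS borel (\<lambda>\<omega>. \<omega> (f, i)) = ?D" for i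
  proof -
    have "distr CS borel (\<lambda>\<omega>. \<omega> (f, i)) = distr CS lborel (\<lambda>\<omega>. \<omega> (f, i))" by (intro distr_cong) auto
    then show ?thesis using distributed_distr_eq_density[OF distributed_coordinate[OF assms]] by simp
  qed
  have "distr CS (PiM UNIV (\<lambda>_. ?D)) (\<lambda>\<omega>. \<lambda>i\<in>UNIV. \<omega> (f, i)) = PiM UNIV (\<lambda>_. ?D)"
    unfolding cascade_space_def
    using distr_PiM_reindex[of "set (flows N) \<times> UNIV" EXPD "\<lambda>i. (f, i)" UNIV] prob_space_component assms
    by (auto simp: inj_on_def)
  moreover have "distr CS (PiM UNIV (\<lambda>_. ?D)) (\<lambda>\<omega>. \<lambda>i\<in>UNIV. \<omega> (f, i))
      = distr CS (PiM UNIV (\<lambda>_. borel)) (\<lambda>\<omega>. \<lambda>i\<in>UNIV. \<omega> (f, i))"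
    by (intro distr_cong sets_PiM_cong) auto
  ultimately show ?thesis
    using measurable_coordinate[OF assms]
    by (subst indep_vars_iff_distr_eq_PiM) (auto simp: D)
qed

text \<open>A sum of \<open>m\<close> independent exponential gaps is Erlang distributed with mean
  \<open>m / r\<close> and variance \<open>m / r^2\<close>; the bound is Chebyshev's
  inequality.\<close>

lemma psum_deviation:
  assumes f: "f \<in> set (flows N)" and a: "0 < a"
  shows "{\<omega> \<in> space CS. a \<le> \<bar>psum \<omega> f m - real m / rate lam beta f\<bar>} \<in> sets CS"
    and "measure CS {\<omega> \<in> space CS. a \<le> \<bar>psum \<omega> f m - real m / rate lam beta f\<bar>}
       \<le> real m / ((rate lam beta f)\<^sup>2 * a\<^sup>2)"
proof -
  interpret prob_space CS by (rule prob_space_cascade_space)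
  note [measurable] = measurable_coordinate[OF f]
  let ?r = "rate lam beta f"
  have r: "?r > 0" by (rule rate_pos[OF lam_pos beta_pos f])
  have [measurable]: "(\<lambda>\<omega>. psum \<omega> f m) \<in> borel_measurable CS" unfolding psum_def by measurable
  show "{\<omega> \<in> space CS. a \<le> \<bar>psum \<omega> f m - real m / ?r\<bar>} \<in> sets CS" by measurable
  show "prob {\<omega> \<in> space CS. a \<le> \<bar>psum \<omega> f m - real m / ?r\<bar>} \<le> real m / (?r\<^sup>2 * a\<^sup>2)"
  proof (cases m)
    \<comment> \<open>The Erlang law needs at least one summand; the empty sum does not deviate at
      all.\<close>
    case 0
    then show ?thesis using a by (simp add: psum_def)
  next
    case (Suc k)
    have "distributed CS lborel (\<lambda>\<omega>. \<Sum>i<m. \<omega> (f, i)) (erlang_density (card {..<m} - 1) ?r)"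
      using Suc r distributed_coordinate[OF f] indep_vars_subset[OF indep_coordinates[OF f], of "{..<m}"]
      by (intro exponential_distributed_sum) auto
    then have D: "distributed CS lborel (\<lambda>\<omega>. psum \<omega> f m) (erlang_density k ?r)"
      by (simp add: psum_def Suc)
    have E: "expectation (\<lambda>\<omega>. psum \<omega> f m) = real m / ?r"
      using erlang_ith_moment[OF r D, of 1] Suc by simp
    have V: "variance (\<lambda>\<omega>. psum \<omega> f m) = real m / ?r\<^sup>2"
      using erlang_distributed_variance[OF r D] Suc by simp
    show ?thesis
      using Chebyshev_inequality[OF _ erlang_ith_moment_integrable[OF r D, of 2] a] 
      unfolding E V[unfolded E] by simp
  qed
qed

text \<open>The index, and with it the variance, grows linearly in \<open>t\<close>, while the
  squared deviation grows like \<open>t^2\<close>; the quotient is of order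
  \<open>1 / t\<close>.\<close>

lemma grid_deviation_tendsto_0:
  assumes f: "f \<in> set (flows N)" and \<eta>: "0 < \<eta>" "0 < \<delta>"
  shows "((\<lambda>t. measure CS {\<omega> \<in> space CS. \<delta> * t \<le> \<bar>psum \<omega> f (nat \<lfloor>real g * (\<eta> * t / 4)\<rfloor>)
      - real (nat \<lfloor>real g * (\<eta> * t / 4)\<rfloor>) / rate lam beta f\<bar>}) \<longlongrightarrow> 0) at_top"
proof (rule tendsto_sandwich)
  let ?r = "rate lam beta f"
  let ?C = "real g * \<eta> / (4 * ?r\<^sup>2 * \<delta>\<^sup>2)"
  have r: "?r > 0" by (rule rate_pos[OF lam_pos beta_pos f])
  show "\<forall>\<^sub>F t in at_top. 0 \<le> measure CS {\<omega> \<in> space CS. \<delta> * t \<le> \<bar>psum \<omega> f (nat \<lfloor>real g * (\<eta> * t / 4)\<rfloor>)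
      - real (nat \<lfloor>real g * (\<eta> * t / 4)\<rfloor>) / ?r\<bar>}" by simp
  show "\<forall>\<^sub>F t in at_top. measure CS {\<omega> \<in> space CS. \<delta> * t \<le> \<bar>psum \<omega> f (nat \<lfloor>real g * (\<eta> * t / 4)\<rfloor>)
      - real (nat \<lfloor>real g * (\<eta> * t / 4)\<rfloor>) / ?r\<bar>} \<le> ?C / t"
    using eventually_gt_at_top[of 0]
  proof eventually_elim
    case (elim t)
    let ?m = "nat \<lfloor>real g * (\<eta> * t / 4)\<rfloor>"
    have m: "real ?m \<le> real g * (\<eta> * t / 4)"
      using elim \<eta> by (intro of_nat_floor) simp
    have "measure CS {\<omega> \<in> space CS. \<delta> * t \<le> \<bar>psum \<omega> f ?m - real ?m / ?r\<bar>} \<le> real ?m / (?r\<^sup>2 * (\<delta> * t)\<^sup>2)"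
      by (rule psum_deviation(2)[OF f]) (use \<eta> elim in simp)
    also have "\<dots> \<le> real g * (\<eta> * t / 4) / (?r\<^sup>2 * (\<delta> * t)\<^sup>2)"
      by (intro divide_right_mono m) simp
    also have "\<dots> = ?C / t"
      using elim r \<eta> by (simp add: field_simps power2_eq_square)
    finally show ?case .
  qed
  show "((\<lambda>t. ?C / t) \<longlongrightarrow> 0) at_top"
    by (intro real_tendsto_divide_at_top[OF tendsto_const] filterlim_ident)
qed simp

lemma xproc_in_probability:
  assumes j: "j \<in> {1..N}" and \<epsilon>: "0 < \<epsilon>"
  shows "((\<lambda>t. measure CS {\<omega> \<in> space CS.
            \<bar>real_of_int (xproc N x0 \<omega> t j) / t - ell lam j\<bar> > \<epsilon>}) \<longlongrightarrow> 0) at_top"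
proof -
  interpret prob_space CS by (rule prob_space_cascade_space)
  define K where "K = max 1 (err lam beta j)"
  define X where "X = (\<Sum>k\<in>{1..N}. \<bar>real_of_int (x0 k)\<bar>)"
  \<comment> \<open>Half of \<open>\<epsilon> * t\<close> is reserved for the counting error
    \<open>K * \<eta> * t\<close>, the other half for the initial state, which needs
    \<open>2 * X / \<epsilon> \<le> t\<close>. The maximum in \<open>K\<close> keeps the divisor
    positive.\<close>
  define \<eta> where "\<eta> = \<epsilon> / (2 * K)"
  have K: "1 \<le> K" "err lam beta j \<le> K" by (auto simp: K_def)
  have \<eta>: "0 < \<eta>" using \<epsilon> K by (simp add: \<eta>_def)
  have X: "\<bar>real_of_int (x0 k)\<bar> \<le> X" if "k \<in> {1..N}" for k
    unfolding X_def using that by (intro member_le_sum) auto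
  have X0: "0 \<le> X" by (simp add: X_def sum_nonneg)
  let ?r = "rate lam beta"
  \<comment> \<open>The number of grid points does not depend on \<open>t\<close>, so the union
    bound is a fixed finite sum of terms tending to 0.\<close>
  define G where "G f = nat \<lceil>4 * (?r f + \<eta>) / \<eta> + 3\<rceil>" for f
  define dev where "dev t f g = {\<omega> \<in> space CS. \<eta> / (4 * ?r f) * t \<le>
      \<bar>psum \<omega> f (nat \<lfloor>real g * (\<eta> * t / 4)\<rfloor>) - real (nat \<lfloor>real g * (\<eta> * t / 4)\<rfloor>) / ?r f\<bar>}" for t f g
  have r: "0 < ?r f" if "f \<in> set (flows N)" for f by (rule rate_pos[OF lam_pos beta_pos that])
  have close: "\<bar>real_of_int (xproc N x0 \<omega> t j) / t - ell lam j\<bar> \<le> \<epsilon>"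
    if t: "0 < t" "1 \<le> \<eta> * t / 4" "2 * X / \<epsilon> \<le> t"
      and nn: "\<forall>f\<in>set (flows N). \<forall>i. 0 \<le> \<omega> (f, i)" and sp: "\<omega> \<in> space CS"
      and good: "\<forall>f\<in>set (flows N). \<forall>g\<le>G f. \<omega> \<notin> dev t f g" for t \<omega>
  proof -
    have "regular_flow \<omega> f (?r f) t (\<eta> * t)" if f: "f \<in> set (flows N)" for f
    proof (rule regular_flow_of_grid[where G = "G f"])
      show "4 * (?r f + \<eta>) / \<eta> + 3 \<le> real (G f)" unfolding G_def by linarith
      show "\<bar>psum \<omega> f m - real m / ?r f\<bar> < \<eta> / (4 * ?r f) * t"
        if "g \<le> G f" "m = nat \<lfloor>real g * (\<eta> * t / 4)\<rfloor>" for g m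
        using good f that sp by (force simp: dev_def)
    qed (use nn f r \<eta> t in auto)
    then obtain T where T: "T (length (events_upto N \<omega> t)) = t"
        and reg: "regular_events N lam beta (events_upto N \<omega> t) T (\<eta> * t)"
      using regular_events_upto[OF lam_pos beta_pos, of \<omega> t "\<eta> * t"] t by auto
    interpret regular_events N lam beta "events_upto N \<omega> t" T "\<eta> * t" by (rule reg)
    have "\<bar>real_of_int (xproc N x0 \<omega> t j) - ell lam j * t\<bar> \<le> err lam beta j * (\<eta> * t) + X"
      using crun_upper[of x0, OF X, where j = j and i = "length (events_upto N \<omega> t)"]
        crun_lower[of x0, OF X, where j = j and i = "length (events_upto N \<omega> t)"] j T
      by (simp add: xproc_def abs_le_iff algebra_simps)
    also have "\<dots> \<le> K * (\<eta> * t) + X" using K \<eta> t by (intro add_right_mono mult_right_mono) auto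
    also have "\<dots> \<le> \<epsilon> * t"
      using t \<epsilon> K by (simp add: \<eta>_def field_simps)
    finally have "\<bar>real_of_int (xproc N x0 \<omega> t j) - ell lam j * t\<bar> / t \<le> \<epsilon>"
      using t by (simp add: field_simps)
    moreover have "real_of_int (xproc N x0 \<omega> t j) / t - ell lam j
        = (real_of_int (xproc N x0 \<omega> t j) - ell lam j * t) / t" using t by (simp add: field_simps)
    ultimately show ?thesis using t by (simp add: abs_divide)
  qed
  show ?thesis
  proof (rule tendsto_sandwich)
    show "\<forall>\<^sub>F t in at_top. 0 \<le> prob {\<omega> \<in> space CS. \<bar>real_of_int (xproc N x0 \<omega> t j) / t - ell lam j\<bar> > \<epsilon>}"
      by simp
    show "((\<lambda>t. \<Sum>(f, g)\<in>(SIGMA f:set (flows N). {..G f}). prob (dev t f g)) \<longlongrightarrow> 0) at_top"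
    proof (rule tendsto_null_sum)
      fix fg assume fg: "fg \<in> (SIGMA f:set (flows N). {..G f})"
      show "((\<lambda>t. case fg of (f, g) \<Rightarrow> prob (dev t f g)) \<longlongrightarrow> 0) at_top"
      proof (cases fg)
        case (Pair f g)
        with fg have f: "f \<in> set (flows N)" by simp
        have "((\<lambda>t. prob (dev t f g)) \<longlongrightarrow> 0) at_top"
          unfolding dev_def by (rule grid_deviation_tendsto_0[OF f \<eta>]) (use r[OF f] \<eta> in simp)
        with Pair show ?thesis by simp
      qed
    qed
    have "\<forall>\<^sub>F t in at_top. 0 < t \<and> 4 / \<eta> \<le> t \<and> 2 * X / \<epsilon> \<le> t"
      by (intro eventually_conj eventually_gt_at_top eventually_ge_at_top)
    then show "\<forall>\<^sub>F t in at_top. prob {\<omega> \<in> space CS. \<bar>real_of_int (xproc N x0 \<omega> t j) / t - ell lam j\<bar> > \<epsilon>}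
        \<le> (\<Sum>(f, g)\<in>(SIGMA f:set (flows N). {..G f}). prob (dev t f g))"
    proof eventually_elim
      case (elim t)
      let ?I = "SIGMA f:set (flows N). {..G f}"
      have t: "0 < t" "1 \<le> \<eta> * t / 4" "2 * X / \<epsilon> \<le> t" using elim \<eta> by (auto simp: field_simps)
      have sets: "dev t f g \<in> events" if "f \<in> set (flows N)" for f g
        unfolding dev_def by (rule psum_deviation(1)[OF that]) (use \<eta> t r[OF that] in simp)
      have "prob {\<omega> \<in> space CS. \<bar>real_of_int (xproc N x0 \<omega> t j) / t - ell lam j\<bar> > \<epsilon>}
          \<le> prob (\<Union>(f, g)\<in>?I. dev t f g)"
      \<comment> \<open>The inclusion holds only almost everywhere, because the gaps are nonnegative
        only almost surely.\<close>
      proof (rule finite_measure_mono_AE)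
        show "(\<Union>(f, g)\<in>?I. dev t f g) \<in> events" using sets by (intro sets.finite_UN) auto
        show "AE \<omega> in CS. \<omega> \<in> {\<omega> \<in> space CS. \<bar>real_of_int (xproc N x0 \<omega> t j) / t - ell lam j\<bar> > \<epsilon>}
            \<longrightarrow> \<omega> \<in> (\<Union>(f, g)\<in>?I. dev t f g)"
          using AE_coordinate_nonneg
        proof eventually_elim
          case (elim \<omega>)
          show ?case using close[OF t elim] by fastforce
        qed
      qed
      also have "\<dots> \<le> (\<Sum>fg\<in>?I. prob (case fg of (f, g) \<Rightarrow> dev t f g))"
        using sets by (intro finite_measure_subadditive_finite) auto
      also have "\<dots> = (\<Sum>(f, g)\<in>?I. prob (dev t f g))" by (intro sum.cong) auto
      finally show ?case .
    qed
  qed simp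
qed

end

text \<open>Bounding every interval on which \<open>ell\<close> is constant amounts to bounding the
  maximal ones, the groups. Measurability is part of the conclusion because \<open>measure\<close>
  is 0 on non-measurable sets, so that the limit alone would not express convergence in
  probability.\<close>

theorem theorem4:
  fixes N :: nat and lam beta :: "nat \<Rightarrow> real" and x0 :: "nat \<Rightarrow> int"
  assumes lam_pos: "\<forall>k\<in>{1..N}. lam k > 0"
    and lam_distinct: "inj_on lam {1..N}"
    and beta_pos: "\<forall>k\<in>{1..<N}. beta k > 0"
    and groups: "\<forall>a b. 1 \<le> a \<longrightarrow> a \<le> b \<longrightarrow> b \<le> N \<longrightarrow>
                   (\<forall>m\<in>{a..b}. ell lam m = ell lam a) \<longrightarrow> card {a..b} \<le> 3"
  shows "\<forall>j\<in>{1..N}.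
           (\<forall>t. (\<lambda>\<omega>. xproc N x0 \<omega> t j) \<in> measurable (cascade_space N lam beta) (count_space UNIV))
         \<and> (\<forall>\<epsilon>>0. ((\<lambda>t. measure (cascade_space N lam beta)
                  {\<omega> \<in> space (cascade_space N lam beta).
                     \<bar>real_of_int (xproc N x0 \<omega> t j) / t - ell lam j\<bar> > \<epsilon>}) \<longlongrightarrow> 0) at_top)"
  using measurable_xproc xproc_in_probability[OF lam_pos beta_pos] by blast

end
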